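(* Let $\mathbf{a}\in K$. Then $\mathbf{a}$ is an extreme point of $K$ if and only if there exists a sequence of integers $k_1,\ldots,k_n,\ldots$ with $k_n\ge 2$ for all $n\ge 1$ such that $$\mathbf{a}=\left(\underbrace{\frac{1}{k_1},\ldots,\frac{1}{k_1}}_{k_1-1},\underbrace{\frac{1}{k_1k_2},\ldots,\frac{1}{k_1k_2}}_{k_2-1},\ldots,\underbrace{\frac{1}{k_1\cdots k_n},\ldots,\frac{1}{k_1\cdots k_n}}_{k_n-1},\ldots\right).$$
   Context: $K\subset\ell_1$ denotes the (convex) set of all non-increasing sequences $\mathbf{a}=(a_n)_{n\ge 1}$ of (strictly) positive real numbers such that $\sum_{n=1}^\infty a_n\le 1$ and $a_n\le 1-\sum_{k=1}^n a_k$ for all $n\ge 1$. The underbraces indicate the number of repetitions: the value $\frac{1}{k_1\cdots k_n}$ is listed $k_n-1$ times in the $n$-th block. *)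

theory Defs
  imports "HOL-Analysis.Analysis"
begin

(* Sequences are indexed from 0: "coord a n" is the mathematical term a_(n+1).
   Extremality only depends on the vector space structure, so no norm is installed on ell1. *)

typedef ell1 = "{f :: nat \<Rightarrow> real. summable (\<lambda>n. \<bar>f n\<bar>)}"
  morphisms coord Abs_ell1
  by (rule exI[of _ "\<lambda>_. 0"]) simp

setup_lifting type_definition_ell1

instantiation ell1 :: real_vector
begin

lift_definition zero_ell1 :: ell1 is "\<lambda>_. 0"
  by simp

lift_definition plus_ell1 :: "ell1 \<Rightarrow> ell1 \<Rightarrow> ell1" is "\<lambda>f g n. f n + g n"
proof -
  fix f g :: "nat \<Rightarrow> real"
  assume "summable (\<lambda>n. \<bar>f n\<bar>)" "summable (\<lambda>n. \<bar>g n\<bar>)"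
  then have "summable (\<lambda>n. \<bar>f n\<bar> + \<bar>g n\<bar>)"
    by (rule summable_add)
  then show "summable (\<lambda>n. \<bar>f n + g n\<bar>)"
    by (rule summable_comparison_test'[where N = 0]) (simp add: abs_triangle_ineq)
qed

lift_definition uminus_ell1 :: "ell1 \<Rightarrow> ell1" is "\<lambda>f n. - f n"
  by simp

lift_definition minus_ell1 :: "ell1 \<Rightarrow> ell1 \<Rightarrow> ell1" is "\<lambda>f g n. f n - g n"
proof -
  fix f g :: "nat \<Rightarrow> real"
  assume "summable (\<lambda>n. \<bar>f n\<bar>)" "summable (\<lambda>n. \<bar>g n\<bar>)"
  then have "summable (\<lambda>n. \<bar>f n\<bar> + \<bar>g n\<bar>)"
    by (rule summable_add)
  then show "summable (\<lambda>n. \<bar>f n - g n\<bar>)"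
    by (rule summable_comparison_test'[where N = 0]) (simp add: abs_triangle_ineq4)
qed

lift_definition scaleR_ell1 :: "real \<Rightarrow> ell1 \<Rightarrow> ell1" is "\<lambda>c f n. c * f n"
  by (simp add: abs_mult summable_mult)

instance
  by standard (transfer; simp add: algebra_simps fun_eq_iff)+

end

definition K :: "ell1 set" where
  "K = {a. decseq (coord a) \<and> (\<forall>n. 0 < coord a n) \<and> (\<Sum>n. coord a n) \<le> 1 \<and>
           (\<forall>n. coord a n \<le> 1 - (\<Sum>i\<le>n. coord a i))}"

(* "k i" is the mathematical k_(i+1). Block n occupies the k n - 1 positions that follow the
   earlier blocks; when all k i \<ge> 2 the blocks are nonempty and cover every index exactly once,
   so the whole sequence is determined. *)
definition has_blocks :: "(nat \<Rightarrow> nat) \<Rightarrow> (nat \<Rightarrow> real) \<Rightarrow> bool" where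
  "has_blocks k f \<longleftrightarrow>
     (\<forall>n. \<forall>j < k n - 1. f ((\<Sum>i<n. (k i - 1)) + j) = 1 / real (\<Prod>i\<le>n. k i))"

end

theory Submission
  imports Defs
begin

text \<open>
  Write \<open>r\<^sub>n = 1 - (a\<^sub>1 + \<dots> + a\<^sub>n)\<close>, so that the last constraint reads \<open>a\<^sub>n \<le> r\<^sub>n\<close>.
  If some maximal constant run of \<open>a\<close> ends at \<open>n\<close> with \<open>a\<^sub>n < r\<^sub>n\<close>, then the common value of
  that run can be moved slightly in both directions while the whole tail is rescaled so
  that it keeps the same proportions to \<open>r\<^sub>n\<close>; hence \<open>a\<close> is not extreme. So for an extreme point
  \<open>a\<^sub>n = r\<^sub>n\<close> at the end of each run, and a run of length \<open>k - 1\<close> starting from the remainder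
  \<open>R\<close> has the value \<open>R / k\<close> and leaves the remainder \<open>R / k\<close>. Conversely, if a sequence with
  these blocks is a proper convex combination of two points of \<open>K\<close>, then both of them
  are constant on each block and satisfy \<open>a\<^sub>n = r\<^sub>n\<close> at its end, which determines their
  values.
\<close>

section \<open>Remainders, and membership in \<open>K\<close> in terms of them\<close>

definition rest :: "(nat \<Rightarrow> real) \<Rightarrow> nat \<Rightarrow> real" where
  "rest f n = 1 - (\<Sum>i<n. f i)"

lemma rest_0 [simp]: "rest f 0 = 1"
  by (simp add: rest_def)

lemma rest_Suc [simp]: "rest f (Suc n) = rest f n - f n"
  by (simp add: rest_def)

lemma rest_cong: "(\<And>i. i < n \<Longrightarrow> f i = g i) \<Longrightarrow> rest f n = rest g n"
  by (simp add: rest_def)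

lemma rest_add_const:
  "(\<And>j. j < l \<Longrightarrow> f (m + j) = c) \<Longrightarrow> rest f (m + l) = rest f m - real l * c"
  by (induction l) (auto simp: algebra_simps)

lemma rest_convex:
  assumes "\<And>i. h i = (1 - u) * f i + u * g i"
  shows "rest h n = (1 - u) * rest f n + u * rest g n"
  by (induction n) (auto simp: assms algebra_simps)

lemma coord_plus: "coord (x + y) i = coord x i + coord y i"
  by transfer simp

lemma coord_minus: "coord (x - y) i = coord x i - coord y i"
  by transfer simp

lemma coord_scaleR: "coord (c *\<^sub>R x) i = c * coord x i"
  by transfer simp

lemma coord_zero: "coord 0 i = 0"
  by transfer simp

lemma summable_coord: "summable (coord x)"
  by transfer (rule summable_rabs_cancel)

text \<open>The total mass is controlled through partial sums: \<open>coord x n\<close> is positive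
  and at most the remainder after it, so every partial sum stays below 1.\<close>

lemma K_iff:
  "x \<in> K \<longleftrightarrow> decseq (coord x) \<and> (\<forall>n. 0 < coord x n) \<and>
     (\<forall>n. coord x n \<le> rest (coord x) (Suc n))"
proof -
  have "(\<Sum>n. coord x n) \<le> 1"
    if "\<forall>n. 0 < coord x n" "\<forall>n. coord x n \<le> rest (coord x) (Suc n)"
  proof (rule suminf_le_const[OF summable_coord])
    fix n
    have "sum (coord x) {..<Suc n} \<le> 1"
      using that(1)[rule_format, of n] that(2)[rule_format, of n] by (simp add: rest_def)
    then show "sum (coord x) {..<n} \<le> 1"
      using that(1)[rule_format, of n] by simp
  qed
  then show ?thesis
    unfolding K_def rest_def lessThan_Suc_atMost by blast
qed

section \<open>Perturbing a single run and its tail\<close>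

lemma not_extreme_point_perturbation:
  fixes x v :: "'a::real_vector"
  assumes "x + v \<in> S" "x - v \<in> S" "v \<noteq> 0"
  shows "\<not> x extreme_point_of S"
proof -
  have "x + v \<noteq> x - v"
  proof
    assume "x + v = x - v"
    then have "2 *\<^sub>R v = 0"
      by (simp add: scaleR_2 algebra_simps)
    with assms(3) show False by simp
  qed
  moreover have "x = (1 - 1/2) *\<^sub>R (x + v) + (1/2) *\<^sub>R (x - v)"
  proof -
    have "(1 - 1/2) *\<^sub>R (x + v) + (1/2) *\<^sub>R (x - v) = (1/2 + 1/2 :: real) *\<^sub>R x"
      unfolding scaleR_add_left by (simp add: algebra_simps)
    then show ?thesis by simp
  qed
  ultimately have "x \<in> open_segment (x + v) (x - v)"
    unfolding in_segment by (intro conjI exI[of _ "1/2"]) auto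
  with assms show ?thesis
    unfolding extreme_point_of_def by blast
qed

text \<open>Serves to impose finitely many smallness conditions on one step size \<open>e\<close> at
  once.\<close>

lemma eventually_at_right_0_mult_less:
  fixes p q :: real
  assumes "0 < p"
  shows "\<forall>\<^sub>F e in at_right 0. q * e < p"
proof (rule order_tendstoD(2))
  show "((\<lambda>e. q * e) \<longlongrightarrow> 0) (at_right 0)"
    by (auto intro!: tendsto_eq_intros)
qed (rule assms)

text \<open>Shifting the run by \<open>d\<close> lowers the remainder after it by
  \<open>real (Suc n - m) * d\<close>. The choice of \<open>l\<close> makes this a scaling by
  \<open>1 - l * d\<close>, and scaling all later terms by the same factor preserves that
  proportion.\<close>

lemma rest_run_perturbation:
  fixes f g :: "nat \<Rightarrow> real"
  assumes g: "\<And>i. g i = f i + d * (if i < m then 0 else if i \<le> n then 1 else - l * f i)"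
    and "m \<le> n" and l: "l * rest f (Suc n) = real (Suc n - m)"
  shows "rest g j = (if j \<le> m then rest f j else if j \<le> Suc n then rest f j - real (j - m) * d
            else (1 + - l * d) * rest f j)"
proof (induction j)
  case (Suc j)
  consider "j < m" | "m \<le> j" "j \<le> n" | "j = Suc n" | "Suc n < j" by linarith
  then show ?case
  proof cases
    \<comment> \<open>This is the seam: the run formula at \<open>Suc n\<close> must turn into the
      tail formula, which is what \<open>l\<close> ensures.\<close>
    case 3
    have "real (Suc n - m) * d = l * d * rest f (Suc n)"
      using l by (simp add: algebra_simps)
    with 3 show ?thesis
      using Suc \<open>m \<le> n\<close> by (simp add: g algebra_simps del: rest_Suc) (simp add: algebra_simps)
  qed (use Suc \<open>m \<le> n\<close> in \<open>auto simp: g algebra_simps Suc_diff_le\<close>)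
qed simp

text \<open>The bounds on \<open>e\<close> guard one constraint each: \<open>l * e < 1\<close> keeps
  the tail positive, the next two keep monotonicity at the left and right ends of the run, and the
  last keeps the run below its remainders.\<close>

lemma K_run_perturbation:
  assumes x: "x \<in> K" and y: "\<And>i. coord y i = coord x i + d * (if i < m then 0 else if i \<le> n then 1 else - l * coord x i)"
    and "m \<le> n" and run: "\<And>i. m \<le> i \<Longrightarrow> i \<le> n \<Longrightarrow> coord x i = c"
    and l: "l * rest (coord x) (Suc n) = real (Suc n - m)" and "0 \<le> l"
    and d: "\<bar>d\<bar> \<le> e" "l * e < 1"
      "\<And>i. i < m \<Longrightarrow> c + e \<le> coord x i"
      "coord x (Suc n) * (1 + l * e) \<le> c - e"
      "c + e + real (Suc n - m) * e \<le> rest (coord x) (Suc n)"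
  shows "y \<in> K"
proof -
  let ?f = "coord x" and ?g = "coord y"
  have dec: "?f (Suc i) \<le> ?f i" and pos: "0 < ?f i" and le: "?f i \<le> rest ?f (Suc i)" for i
    using x by (auto simp: K_iff decseq_Suc_iff)
  have ld: "\<bar>l * d\<bar> \<le> l * e"
    using d(1) \<open>0 \<le> l\<close> by (simp add: abs_mult mult_left_mono)
  have scale: "0 < 1 - l * d" "1 - l * d \<le> 1 + l * e"
    using ld d(2) by auto
  have g1: "?g i = ?f i" if "i < m" for i using that y by simp
  have g2: "?g i = c + d" if "m \<le> i" "i \<le> n" for i using that y run by simp
  have g3: "?g i = (1 - l * d) * ?f i" if "n < i" for i
    using that y \<open>m \<le> n\<close> by (simp add: algebra_simps)
  have next_le: "(1 - l * d) * ?f (Suc n) \<le> c + d"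
  proof -
    have "(1 - l * d) * ?f (Suc n) \<le> (1 + l * e) * ?f (Suc n)"
      using scale pos[of "Suc n"] by (intro mult_right_mono) auto
    then show ?thesis using d(1,4) by (simp add: mult.commute)
  qed
  have gpos: "0 < ?g i" for i
  proof -
    \<comment> \<open>On the run, positivity of \<open>c + d\<close> comes from
      \<open>next_le\<close>: it dominates the positive rescaled term after the run.\<close>
    have "0 < (1 - l * d) * ?f j" for j using scale pos[of j] by simp
    then show ?thesis
      using pos[of i] g1[of i] g2[of i] g3[of i] next_le
      by (metis less_le_trans linorder_not_le)
  qed
  have "?g (Suc i) \<le> ?g i" for i
  proof -
    consider "Suc i < m" | "Suc i = m" | "m \<le> i" "i < n" | "i = n" | "n < i" by linarith
    then show ?thesis
    proof cases
      case 2
      then show ?thesis using d(1) d(3)[of i] g1[of i] g2[of "Suc i"] \<open>m \<le> n\<close> by simp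
    next
      case 5
      then show ?thesis using dec[of i] g3[of i] g3[of "Suc i"] scale by (simp add: mult_left_mono)
    qed (use dec[of i] g1[of i] g1[of "Suc i"] g2[of i] g2[of "Suc i"] g3[of "Suc i"] next_le \<open>m \<le> n\<close>
          in simp_all)
  qed
  moreover have "?g j \<le> rest ?g (Suc j)" for j
  proof -
    have R: "rest ?g (Suc j) = (if j < m then rest ?f (Suc j) else if j \<le> n
        then rest ?f (Suc j) - real (Suc j - m) * d else (1 + - l * d) * rest ?f (Suc j))"
      using rest_run_perturbation[OF y \<open>m \<le> n\<close> l, of "Suc j"] by (simp add: Suc_le_eq del: rest_Suc)
    consider "j < m" | "m \<le> j" "j \<le> n" | "n < j" by linarith
    then show ?thesis
    proof cases
      case 1 then show ?thesis using R g1 le[of j] by simp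
    next
      case 2
      \<comment> \<open>On the run the old remainder is smallest at its end, and the total shift is
        at most \<open>real (Suc n - m) * e\<close>; so the bound at \<open>Suc n\<close> covers
        every \<open>j\<close> in the run.\<close>
      have anti: "rest ?f (Suc n) \<le> rest ?f (Suc j)"
        unfolding rest_def using 2 pos
        by (intro diff_left_mono sum_mono2) (auto intro: less_imp_le)
      have "real (Suc j - m) * d \<le> real (Suc n - m) * e"
        using 2 d(1) by (intro order.trans[OF mult_left_mono[of d e] mult_right_mono]) auto
      then show ?thesis using R g2 2 d(1,5) anti by (simp del: rest_Suc)
    next
      case 3 then show ?thesis
        using R g3[of j] le[of j] scale mult_left_mono[OF le[of j], of "1 - l * d"] \<open>m \<le> n\<close>
        by (simp del: rest_Suc)
    qed
  qed
  ultimately show ?thesis using gpos by (simp add: K_iff decseq_Suc_iff del: rest_Suc)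
qed

lemma extreme_point_run_end:
  assumes ext: "x extreme_point_of K" and lt: "coord x (Suc n) < coord x n"
  shows "coord x n = rest (coord x) (Suc n)"
proof (rule ccontr)
  assume ne: "coord x n \<noteq> rest (coord x) (Suc n)"
  have x: "x \<in> K" using ext by (simp add: extreme_point_of_def)
  let ?f = "coord x"
  define c where "c = ?f n"
  have mono: "decseq ?f" and pos: "0 < ?f i" and le: "?f i \<le> rest ?f (Suc i)" for i
    using x by (auto simp: K_iff)
  \<comment> \<open>By monotonicity, the indices from \<open>m\<close> to \<open>n\<close> form the
    whole run with value \<open>c\<close>, and all earlier terms are strictly larger.\<close>
  define m where "m = (LEAST i. ?f i = c)"
  have fm: "?f m = c" unfolding m_def by (rule LeastI[of _ n]) (simp add: c_def)
  have "m \<le> n" unfolding m_def by (rule Least_le) (simp add: c_def)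
  have run: "?f i = c" if "m \<le> i" "i \<le> n" for i
    using decseqD[OF mono that(1)] decseqD[OF mono that(2)] fm c_def by simp
  have before: "c < ?f i" if "i < m" for i
    using not_less_Least[of i "\<lambda>i. ?f i = c"] that decseqD[OF mono, of i m] fm
    unfolding m_def[symmetric] by (simp add: less_le)
  define l where "l = real (Suc n - m) / rest ?f (Suc n)"
  have rpos: "c < rest ?f (Suc n)" using le[of n] ne unfolding c_def by linarith
  have "0 < c" using pos c_def by simp
  have l: "l * rest ?f (Suc n) = real (Suc n - m)" "0 \<le> l"
    using rpos \<open>0 < c\<close> unfolding l_def by auto
  define w where "w i = (if i < m then 0 else if i \<le> n then 1 else - l * ?f i)" for i
  have "summable (\<lambda>i. \<bar>- l * ?f i\<bar>)"
    using summable_mult[OF summable_coord[of x], of l] l(2) pos by (simp add: abs_mult less_imp_le)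
  \<comment> \<open>Beyond \<open>n\<close> the direction \<open>w\<close> coincides with
    \<open>- l * ?f i\<close>, and finitely many terms do not affect summability.\<close>
  then have "summable (\<lambda>i. \<bar>w i\<bar>)"
    by (rule summable_cong[THEN iffD1, rotated])
       (auto simp: w_def eventually_sequentially intro!: exI[of _ "Suc (m + n)"])
  then obtain v where v: "coord v i = w i" for i
    using Abs_ell1_inverse by (metis mem_Collect_eq)
  \<comment> \<open>Each condition of \<open>K_run_perturbation\<close> has strict slack at
    \<open>e = 0\<close>, so all of them hold together for some small positive
    \<open>e\<close>.\<close>
  have "\<forall>\<^sub>F e in at_right 0. 0 < (e::real)"
    by (simp add: eventually_at_right_less)
  moreover have "\<forall>\<^sub>F e in at_right 0. l * e < 1"
    by (simp add: eventually_at_right_0_mult_less)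
  moreover have "\<forall>\<^sub>F e in at_right 0. \<forall>i\<in>{..<m}. 1 * e < ?f i - c"
    by (intro eventually_ball_finite ballI eventually_at_right_0_mult_less)
       (use before in auto)
  moreover have "\<forall>\<^sub>F e in at_right 0. (l * ?f (Suc n) + 1) * e < c - ?f (Suc n)"
    using lt by (intro eventually_at_right_0_mult_less) (simp add: c_def)
  moreover have "\<forall>\<^sub>F e in at_right 0. (1 + real (Suc n - m)) * e < rest ?f (Suc n) - c"
    using rpos by (intro eventually_at_right_0_mult_less) (simp del: rest_Suc)
  ultimately have "\<forall>\<^sub>F e in at_right 0. 0 < e \<and> l * e < 1 \<and> (\<forall>i\<in>{..<m}. 1 * e < ?f i - c) \<and>
      (l * ?f (Suc n) + 1) * e < c - ?f (Suc n) \<and>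
      (1 + real (Suc n - m)) * e < rest ?f (Suc n) - c"
    by eventually_elim blast
  then have "\<exists>e. 0 < e \<and> l * e < 1 \<and> (\<forall>i\<in>{..<m}. 1 * e < ?f i - c) \<and>
      (l * ?f (Suc n) + 1) * e < c - ?f (Suc n) \<and>
      (1 + real (Suc n - m)) * e < rest ?f (Suc n) - c"
    by (rule eventually_happens'[OF trivial_limit_at_right_real])
  then obtain e where e: "0 < e" "l * e < 1" "\<And>i. i < m \<Longrightarrow> e < ?f i - c"
      "(l * ?f (Suc n) + 1) * e < c - ?f (Suc n)"
      "(1 + real (Suc n - m)) * e < rest ?f (Suc n) - c"
    by (auto simp del: rest_Suc)
  have K: "y \<in> K" if "\<bar>d\<bar> \<le> e" "\<And>i. coord y i = ?f i + d * w i" for d y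
  proof (rule K_run_perturbation[OF x _ \<open>m \<le> n\<close> run l that(1) e(2)])
    show "coord y i = ?f i + d * (if i < m then 0 else if i \<le> n then 1 else - l * ?f i)" for i
      using that(2)[of i] unfolding w_def .
    show "c + e \<le> ?f i" if "i < m" for i using e(3)[OF that] by simp
    show "?f (Suc n) * (1 + l * e) \<le> c - e" using e(4) by (simp add: algebra_simps)
    show "c + e + real (Suc n - m) * e \<le> rest ?f (Suc n)"
      using e(5) by (simp add: algebra_simps del: rest_Suc)
  qed
  \<comment> \<open>Index \<open>n\<close> lies in the run, where \<open>w\<close> is 1.\<close>
  have "e *\<^sub>R v \<noteq> 0"
    using e(1) v[of n] \<open>m \<le> n\<close> coord_zero[of n] by (auto simp: w_def)
  moreover have "x + e *\<^sub>R v \<in> K"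
    using e(1) by (intro K[of e]) (auto simp: v coord_plus coord_scaleR)
  moreover have "x - e *\<^sub>R v \<in> K"
    using e(1) by (intro K[of "- e"]) (auto simp: v coord_minus coord_scaleR)
  ultimately show False
    using not_extreme_point_perturbation ext by blast
qed

section \<open>Reading off the block lengths from the run ends\<close>

lemma has_blocks_if_run_ends:
  assumes x: "x \<in> K"
    and ends: "\<And>n. coord x (Suc n) < coord x n \<Longrightarrow> coord x n = rest (coord x) (Suc n)"
  shows "\<exists>k. (\<forall>n. 2 \<le> k n) \<and> has_blocks k (coord x)"
proof -
  let ?f = "coord x"
  have mono: "decseq ?f" and pos: "0 < ?f i" for i
    using x by (auto simp: K_iff)
  \<comment> \<open>Without a later descent the sequence would never fall below
    \<open>?f s > 0\<close>, although summability forces the limit 0.\<close>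
  have ex: "\<exists>e\<ge>s. ?f (Suc e) < ?f e" for s
  proof (rule ccontr)
    assume "\<not> ?thesis"
    then have step: "?f e \<le> ?f (Suc e)" if "s \<le> e" for e
      using that by (meson linorder_not_le)
    have "?f s \<le> ?f e" if "s \<le> e" for e
      using that by (induction e rule: dec_induct) (auto intro: order.trans[OF _ step])
    then have "?f s \<le> 0"
      by (intro LIMSEQ_le_const[OF summable_LIMSEQ_zero[OF summable_coord]]) blast
    with pos[of s] show False by simp
  qed
  define E where "E s = (LEAST e. s \<le> e \<and> ?f (Suc e) < ?f e)" for s
  have E: "s \<le> E s" "?f (Suc (E s)) < ?f (E s)" for s
    using LeastI_ex[OF ex[of s, unfolded Bex_def]] unfolding E_def by auto
  have const: "?f i = ?f s" if "s \<le> i" "i \<le> E s" for s i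
    using that
  proof (induction i rule: dec_induct)
    case (step i)
    then have "\<not> ?f (Suc i) < ?f i"
      using not_less_Least[of i "\<lambda>e. s \<le> e \<and> ?f (Suc e) < ?f e"] unfolding E_def by simp
    with step decseqD[OF mono, of i "Suc i"] show ?case by simp
  qed simp
  \<comment> \<open>\<open>s n\<close> is the start of the run number \<open>n\<close>, since
    \<open>E\<close> returns the last index of a run.\<close>
  define s where "s = rec_nat 0 (\<lambda>_ s. Suc (E s))"
  have s: "s 0 = 0" "s (Suc n) = Suc (E (s n))" for n
    by (simp_all add: s_def)
  \<comment> \<open>The run has \<open>E (s n) - s n + 1\<close> terms, and a block has
    \<open>k n - 1\<close>.\<close>
  define k where "k n = E (s n) - s n + 2" for n
  have sum: "(\<Sum>i<n. (k i - 1)) = s n" for n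
  proof (induction n)
    case (Suc n)
    then show ?case using E(1)[of "s n"] by (simp add: s k_def)
  qed (simp add: s)
  have block: "?f (s n + j) = rest ?f (s n) / real (k n)"
    and after: "rest ?f (s (Suc n)) = rest ?f (s n) / real (k n)" if "j < k n - 1" for n j
  proof -
    have c: "?f (s n + j) = ?f (s n)" if "j < k n - 1" for j
      using that E(1)[of "s n"] by (intro const) (auto simp: k_def)
    have Suc: "s (Suc n) = s n + (k n - 1)" using E(1)[of "s n"] by (simp add: s k_def)
    \<comment> \<open>With \<open>R\<close> the remainder before the run and \<open>v\<close> its
      value, \<open>v = R - (k n - 1) * v\<close>, hence \<open>v = R / k n\<close>; the new
      remainder is \<open>v\<close> as well.\<close>
    have "rest ?f (s (Suc n)) = rest ?f (s n) - real (k n - 1) * ?f (s n)"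
      unfolding Suc by (rule rest_add_const, rule c)
    moreover have end_eq: "?f (s n) = rest ?f (s (Suc n))"
      using ends[OF E(2)[of "s n"]] const[OF E(1) order.refl, of "s n"] by (simp add: s)
    ultimately have "?f (s n) = rest ?f (s n) / real (k n)"
      by (simp add: k_def field_simps)
    with c[OF that] end_eq show "?f (s n + j) = rest ?f (s n) / real (k n)"
      "rest ?f (s (Suc n)) = rest ?f (s n) / real (k n)" by simp_all
  qed
  have "rest ?f (s n) = 1 / real (\<Prod>i<n. k i)" for n
  proof (induction n)
    case (Suc n)
    \<comment> \<open>\<open>after\<close> carries a premise on \<open>j\<close>; position 0 of the
      block satisfies it.\<close>
    have "0 < k n - 1" by (simp add: k_def)
    from after[OF this] Suc show ?case by (simp add: mult.commute)
  qed (simp add: s)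
  then have "has_blocks k ?f"
    unfolding has_blocks_def sum lessThan_Suc_atMost[symmetric]
    by (auto simp: block mult.commute)
  then show ?thesis by (intro exI[of _ k]) (auto simp: k_def)
qed

section \<open>Sequences with blocks are extreme points\<close>

lemma rest_blocks:
  assumes k: "\<And>n. 2 \<le> k n" and f: "has_blocks k f"
  shows "rest f (\<Sum>i<n. (k i - 1)) = 1 / real (\<Prod>i<n. k i)"
proof (induction n)
  case (Suc n)
  let ?s = "\<Sum>i<n. (k i - 1)" and ?P = "real (\<Prod>i<n. k i)"
  have "real (k n - 1) = real (k n) - 1" using k[of n] by (simp)
  moreover have "rest f (?s + (k n - 1)) = rest f ?s - real (k n - 1) * (1 / (?P * real (k n)))"
    using f by (intro rest_add_const)
      (simp add: has_blocks_def lessThan_Suc_atMost[symmetric])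
  moreover have "?P \<noteq> 0" "real (k n) \<noteq> 0"
    using k by (metis not_numeral_le_zero of_nat_eq_0_iff prod_zero_iff finite_lessThan)
       (use k[of n] in simp)
  ultimately show ?case using Suc by (simp add: field_simps)
qed simp

text \<open>Transfers tight constraints: an inequality of \<open>K\<close> that is an equality for
  an interior point of a segment is one for both endpoints.\<close>

lemma convex_combination_eq_imp_eq:
  fixes p q p' q' u :: real
  assumes "p \<le> p'" "q \<le> q'" "0 < u" "u < 1" "(1 - u) * p + u * q = (1 - u) * p' + u * q'"
  shows "p = p'" "q = q'"
proof -
  have "(1 - u) * (p' - p) + u * (q' - q) = 0" using assms(5) by (simp add: algebra_simps)
  moreover have "0 \<le> (1 - u) * (p' - p)" "0 \<le> u * (q' - q)" using assms by auto
  ultimately have "(1 - u) * (p' - p) = 0" "u * (q' - q) = 0" by linarith+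
  then show "p = p'" "q = q'" using assms by auto
qed

lemma extreme_point_if_has_blocks:
  assumes a: "a \<in> K" and k: "\<And>n. 2 \<le> k n" and blocks: "has_blocks k (coord a)"
  shows "a extreme_point_of K"
  unfolding extreme_point_of_def
proof (intro conjI ballI notI)
  fix x y assume x: "x \<in> K" and y: "y \<in> K" and seg: "a \<in> open_segment x y"
  then obtain u where "x \<noteq> y" and u: "0 < u" "u < 1" and comb: "a = (1 - u) *\<^sub>R x + u *\<^sub>R y"
    unfolding in_segment by blast
  let ?f = "coord a" and ?g = "coord x" and ?h = "coord y"
  have c: "?f i = (1 - u) * ?g i + u * ?h i" for i
    by (simp add: comb coord_plus coord_scaleR)
  define s where "s n = (\<Sum>i<n. (k i - 1))" for n
  have s: "s 0 = 0" "s (Suc n) = s n + (k n - 1)" for n by (simp_all add: s_def)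
  have agree: "\<forall>i < s n. ?g i = ?h i" for n
  proof (induction n)
    case (Suc n)
    \<comment> \<open>\<open>l\<close> is the offset of the last position in block \<open>n\<close>,
      which has \<open>Suc l\<close> terms.\<close>
    define l where "l = k n - 2"
    have kn: "k n - 1 = Suc l" using k[of n] by (simp add: l_def)
    have val: "?f (s n + j) = 1 / real (\<Prod>i\<le>n. k i)" if "j \<le> l" for j
      using blocks that kn unfolding has_blocks_def s_def by simp
    have const: "?g (s n + j) = ?g (s n + l)" "?h (s n + j) = ?h (s n + l)" if "j \<le> l" for j
    proof -
      have "?g (s n + l) \<le> ?g (s n + j)" "?h (s n + l) \<le> ?h (s n + j)"
        using x y that by (auto simp: K_iff intro: decseqD)
      moreover have "(1 - u) * ?g (s n + l) + u * ?h (s n + l) = (1 - u) * ?g (s n + j) + u * ?h (s n + j)"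
        using val[OF that] val[of l] c by simp
      ultimately show "?g (s n + j) = ?g (s n + l)" "?h (s n + j) = ?h (s n + l)"
        using convex_combination_eq_imp_eq u by metis+
    qed
    have "s (Suc n) = Suc (s n + l)" by (simp add: s kn del: One_nat_def)
    moreover have "rest ?f (s (Suc n)) = ?f (s n + l)"
      using rest_blocks[OF k blocks, of "Suc n"] val[of l]
      by (simp add: s_def lessThan_Suc_atMost del: sum.lessThan_Suc prod.lessThan_Suc)
    ultimately have end_eq: "?f (s n + l) = rest ?f (Suc (s n + l))"
      by metis
    have "?g (s n + l) \<le> rest ?g (Suc (s n + l))" "?h (s n + l) \<le> rest ?h (Suc (s n + l))"
      using x y by (auto simp: K_iff simp del: rest_Suc)
    moreover have "(1 - u) * ?g (s n + l) + u * ?h (s n + l) =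
        (1 - u) * rest ?g (Suc (s n + l)) + u * rest ?h (Suc (s n + l))"
      using end_eq unfolding rest_convex[of ?f u ?g ?h, OF c] c .
    ultimately have "?g (s n + l) = rest ?g (s n + Suc l)" "?h (s n + l) = rest ?h (s n + Suc l)"
      using convex_combination_eq_imp_eq u by (metis add_Suc_right)+
    moreover have "rest ?g (s n + Suc l) = rest ?g (s n) - real (Suc l) * ?g (s n + l)"
      "rest ?h (s n + Suc l) = rest ?h (s n) - real (Suc l) * ?h (s n + l)"
      by (rule rest_add_const, rule const, simp)+
    moreover have "rest ?g (s n) = rest ?h (s n)"
      using Suc by (intro rest_cong) simp
    \<comment> \<open>For \<open>x\<close> and for \<open>y\<close>, the block value times
      \<open>1 + Suc l\<close> equals the remainder before the block, on which both agree by
      induction.\<close>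
    ultimately have "(1 + real (Suc l)) * ?g (s n + l) = (1 + real (Suc l)) * ?h (s n + l)"
      by (simp add: algebra_simps del: of_nat_Suc)
    then have last: "?g (s n + l) = ?h (s n + l)" by simp
    show ?case
    proof (intro allI impI)
      fix i assume i: "i < s (Suc n)"
      show "?g i = ?h i"
      proof (cases "i < s n")
        case False
        then obtain j where "i = s n + j" by (metis le_Suc_ex linorder_not_le)
        with i const[of j] last show ?thesis by (simp add: s kn del: One_nat_def)
      qed (use Suc in simp)
    qed
  qed (simp add: s)
  \<comment> \<open>Blocks are nonempty, so their starting points pass every index.\<close>
  have "n \<le> s n" for n
  proof (induction n)
    case (Suc n)
    then show ?case using k[of n] by (simp add: s)
  qed simp
  then have "?g i = ?h i" for i
    using agree[of "Suc i"] Suc_le_lessD by blast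
  then have "x = y" by (simp add: coord_inject[symmetric] fun_eq_iff)
  with \<open>x \<noteq> y\<close> show False by contradiction
qed (rule a)

theorem theorem2p2:
  fixes a :: ell1
  assumes "a \<in> K"
  shows "a extreme_point_of K \<longleftrightarrow>
    (\<exists>k :: nat \<Rightarrow> nat. (\<forall>n. 2 \<le> k n) \<and> has_blocks k (coord a))"
  using has_blocks_if_run_ends[OF assms extreme_point_run_end] extreme_point_if_has_blocks[OF assms]
  by blast

end
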